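(* Let $f,g$ satisfy Assumptions (A1)–(A4) of the context, let $h(z)=\|\nabla_y g(z)\|^2$, and let $\varepsilon,\alpha_b,w,t_{\max}>0$ and $\beta,\alpha_{\mathrm{ls}},\gamma\in(0,1)$. Suppose $h(z^0)\le\varepsilon^2$, and let $\{z^k\},\{\Delta z^k\},\{t^k\}$ be generated by the algorithm described in the context. Then for all $K=0,1,2,\dots$, $$h(z^K)-\varepsilon^2\ \le\ (1-\gamma)^K\,(h(z^0)-\varepsilon^2)\ \le\ 0.$$ Furthermore, for all $K=1,2,\dots$, $$\frac1K\sum_{k=0}^{K-1}\|\Delta z^k\|^2\ \le\ \frac{f(z^0)-f^\star_\varepsilon}{\alpha_{\mathrm{ls}}\,t_{\min}\,K},$$ where $f^\star_\varepsilon=\min\{f(z): h(z)\le\varepsilon^2\}$ and $$t_{\min}=\min\Big\{\beta\,\frac{2(1-\alpha_{\mathrm{ls}})}{L_f},\ \beta\,\frac{\gamma}{\alpha_b},\ \beta\,\frac{2w}{L_h},\ t_{\max}\Big\}$$ with $L_f,L_h>0$ uniform Lipschitz constants of $\nabla f,\nabla h$ as described in the context. In particular, $\lim_{k\to\infty}\|\Delta z^k\|=0$.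
   Context: Write $z=(x,y)\in\mathbb{R}^{n+m}$; $\|\cdot\|$ is the Euclidean norm; $f,g:\mathbb{R}^n\times\mathbb{R}^m\to\mathbb{R}$. $\nabla_y g(z)\in\mathbb{R}^m$ is the partial gradient in $y$, and $\nabla^2_{yx}g(z)\in\mathbb{R}^{m\times n}$, $\nabla^2_{yy}g(z)\in\mathbb{R}^{m\times m}$ are the Jacobians of $\nabla_y g$ with respect to $x$ and $y$. Assumptions: (A1) $f$ is continuously differentiable and $\nabla f$ is locally Lipschitz continuous. (A2) $g$ is twice continuously differentiable and $\nabla^2_{yx}g$, $\nabla^2_{yy}g$ are locally Lipschitz continuous. (A3) For all $z$ with $\nabla_y g(z)\ne0$, $\nabla_y g(z)\notin\mathcal{N}\big([\nabla^2_{yx}g(z)\ \ \nabla^2_{yy}g(z)]^\top\big)$, where $\mathcal{N}$ denotes the null space. (A4) $h$ is coercive: $h(z)\to\infty$ as $\|z\|\to\infty$. Algorithm: start from $z^0$ with $h(z^0)\le\varepsilon^2$. For $k=0,1,2,\dots$: 1. $\Delta z^k$ is the unique minimizer of $\tfrac12\|\Delta z+\nabla f(z^k)\|^2$ over $\Delta z\in\mathbb{R}^{n+m}$ subject to $\nabla h(z^k)^\top\Delta z+\alpha_b(h(z^k)-\varepsilon^2)\le-w\|\Delta z\|^2$. 2. (Backtracking) $t^k$ is the first element $t$ of the sequence $t_{\max},\beta t_{\max},\beta^2t_{\max},\dots$ for which both conditions hold: - Armijo: $f(z^k+t\Delta z^k)\le f(z^k)+\alpha_{\mathrm{ls}}\,t\,\nabla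 f(z^k)^\top\Delta z^k$; - safety: $h(z^k+t\Delta z^k)-\varepsilon^2\le(1-\gamma)(h(z^k)-\varepsilon^2)$. 3. $z^{k+1}=z^k+t^k\Delta z^k$. Lipschitz constants: $L_f,L_h>0$ are Lipschitz constants of $\nabla f$ and $\nabla h$, respectively, on a bounded convex set containing all points $z^k+t\Delta z^k$ with $k\ge0$, $t\in[0,t_{\max}]$. *)

theory Defs
  imports "HOL-Analysis.Analysis"
begin

section \<open>Derivatives\<close>

definition grad :: "('a::euclidean_space \<Rightarrow> real) \<Rightarrow> 'a \<Rightarrow> 'a" where
  "grad f z = (THE D. GDERIV f z :> D)"

lemma grad_eqI:
  assumes "GDERIV f z :> D"
  shows "grad f z = D"
proof -
  have "D' = D" if "GDERIV f z :> D'" for D'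
  proof -
    have "(\<lambda>v. v \<bullet> D') = (\<lambda>v. v \<bullet> D)"
      using that assms unfolding gderiv_def by (rule has_derivative_unique)
    then show ?thesis
      by (metis inner_commute vector_eq_rdot)
  qed
  with assms show ?thesis
    unfolding grad_def by (rule the_equality)
qed

text \<open>
  The norm and inner product of the product type are the Euclidean ones, so
  \<^typ>\<open>(real^'n) \<times> (real^'m)\<close> plays the role of Euclidean space of dimension n + m.
\<close>

definition grad_y :: "((real^'n) \<times> (real^'m) \<Rightarrow> real) \<Rightarrow> (real^'n) \<times> (real^'m) \<Rightarrow> real^'m" where
  "grad_y g z = grad (\<lambda>y. g (fst z, y)) (snd z)"

definition hess_yx :: "((real^'n) \<times> (real^'m) \<Rightarrow> real) \<Rightarrow> (real^'n) \<times> (real^'m) \<Rightarrow> real^'n^'m" where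
  "hess_yx g z = jacobian (\<lambda>x. grad_y g (x, snd z)) (at (fst z))"

definition hess_yy :: "((real^'n) \<times> (real^'m) \<Rightarrow> real) \<Rightarrow> (real^'n) \<times> (real^'m) \<Rightarrow> real^'m^'m" where
  "hess_yy g z = jacobian (\<lambda>y. grad_y g (fst z, y)) (at (snd z))"

section \<open>Smoothness classes\<close>

text \<open>Continuity of the derivative is with respect to the operator norm.\<close>

definition continuously_differentiable ::
    "('a::real_normed_vector \<Rightarrow> 'b::real_normed_vector) \<Rightarrow> bool" where
  "continuously_differentiable F \<longleftrightarrow>
     (\<exists>F' :: 'a \<Rightarrow> 'a \<Rightarrow>\<^sub>L 'b.
        (\<forall>z. (F has_derivative blinfun_apply (F' z)) (at z)) \<and> continuous_on UNIV F')"

definition twice_continuously_differentiable ::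
    "('a::real_normed_vector \<Rightarrow> 'b::real_normed_vector) \<Rightarrow> bool" where
  "twice_continuously_differentiable F \<longleftrightarrow>
     (\<exists>F' :: 'a \<Rightarrow> 'a \<Rightarrow>\<^sub>L 'b.
        (\<forall>z. (F has_derivative blinfun_apply (F' z)) (at z)) \<and> continuously_differentiable F')"

text \<open>
  The library's \<^const>\<open>local_lipschitz\<close> is about families of functions with a parameter;
  here the parameter set is a singleton.
\<close>

definition locally_lipschitz :: "('a::metric_space \<Rightarrow> 'b::metric_space) \<Rightarrow> bool" where
  "locally_lipschitz F \<longleftrightarrow> local_lipschitz {0::real} UNIV (\<lambda>_. F)"

lemma locally_lipschitz_iff:
  "locally_lipschitz F \<longleftrightarrow> (\<forall>z. \<exists>u>0. \<exists>L. L-lipschitz_on (cball z u) F)"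
  unfolding locally_lipschitz_def local_lipschitz_def by simp (meson less_imp_le)

section \<open>Matrices\<close>

definition hcat :: "real^'n^'k \<Rightarrow> real^'m^'k \<Rightarrow> real^('n + 'm)^'k" where
  "hcat A B = (\<chi> i j. case j of Inl a \<Rightarrow> A $ i $ a | Inr b \<Rightarrow> B $ i $ b)"

definition null_space :: "real^'n^'m \<Rightarrow> (real^'n) set" where
  "null_space A = {v. A *v v = 0}"

section \<open>The algorithm\<close>

definition qp_feasible :: "('a::euclidean_space \<Rightarrow> real) \<Rightarrow> real \<Rightarrow> real \<Rightarrow> real \<Rightarrow> 'a \<Rightarrow> 'a \<Rightarrow> bool" where
  "qp_feasible h \<epsilon> \<alpha>\<^sub>b w z d \<longleftrightarrow>
     grad h z \<bullet> d + \<alpha>\<^sub>b * (h z - \<epsilon>\<^sup>2) \<le> - w * (norm d)\<^sup>2"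

definition qp_objective :: "('a::euclidean_space \<Rightarrow> real) \<Rightarrow> 'a \<Rightarrow> 'a \<Rightarrow> real" where
  "qp_objective f z d = 1/2 * (norm (d + grad f z))\<^sup>2"

definition armijo :: "('a::euclidean_space \<Rightarrow> real) \<Rightarrow> real \<Rightarrow> 'a \<Rightarrow> 'a \<Rightarrow> real \<Rightarrow> bool" where
  "armijo f \<alpha>\<^sub>l\<^sub>s z d t \<longleftrightarrow> f (z + t *\<^sub>R d) \<le> f z + \<alpha>\<^sub>l\<^sub>s * t * (grad f z \<bullet> d)"

definition safety :: "('a::euclidean_space \<Rightarrow> real) \<Rightarrow> real \<Rightarrow> real \<Rightarrow> 'a \<Rightarrow> 'a \<Rightarrow> real \<Rightarrow> bool" where
  "safety h \<epsilon> \<gamma> z d t \<longleftrightarrow> h (z + t *\<^sub>R d) - \<epsilon>\<^sup>2 \<le> (1 - \<gamma>) * (h z - \<epsilon>\<^sup>2)"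

definition first_backtrack :: "real \<Rightarrow> real \<Rightarrow> (real \<Rightarrow> bool) \<Rightarrow> real \<Rightarrow> bool" where
  "first_backtrack t\<^sub>m\<^sub>a\<^sub>x \<beta> P t \<longleftrightarrow>
     (\<exists>j. t = \<beta> ^ j * t\<^sub>m\<^sub>a\<^sub>x \<and> P t \<and> (\<forall>i<j. \<not> P (\<beta> ^ i * t\<^sub>m\<^sub>a\<^sub>x)))"

definition generated_by_algorithm ::
    "('a::euclidean_space \<Rightarrow> real) \<Rightarrow> ('a \<Rightarrow> real) \<Rightarrow> real \<Rightarrow> real \<Rightarrow> real \<Rightarrow> real \<Rightarrow> real \<Rightarrow> real \<Rightarrow> real
     \<Rightarrow> (nat \<Rightarrow> 'a) \<Rightarrow> (nat \<Rightarrow> 'a) \<Rightarrow> (nat \<Rightarrow> real) \<Rightarrow> bool" where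
  "generated_by_algorithm f h \<epsilon> \<alpha>\<^sub>b w t\<^sub>m\<^sub>a\<^sub>x \<beta> \<alpha>\<^sub>l\<^sub>s \<gamma> z dz t \<longleftrightarrow>
     (\<forall>k. {d. is_arg_min (qp_objective f (z k)) (qp_feasible h \<epsilon> \<alpha>\<^sub>b w (z k)) d} = {dz k}
        \<and> first_backtrack t\<^sub>m\<^sub>a\<^sub>x \<beta>
             (\<lambda>s. armijo f \<alpha>\<^sub>l\<^sub>s (z k) (dz k) s \<and> safety h \<epsilon> \<gamma> (z k) (dz k) s) (t k)
        \<and> z (Suc k) = z k + t k *\<^sub>R dz k)"

definition uniform_lipschitz_constants ::
    "('a::euclidean_space \<Rightarrow> real) \<Rightarrow> ('a \<Rightarrow> real) \<Rightarrow> real \<Rightarrow> (nat \<Rightarrow> 'a) \<Rightarrow> (nat \<Rightarrow> 'a)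
     \<Rightarrow> real \<Rightarrow> real \<Rightarrow> bool" where
  "uniform_lipschitz_constants f h t\<^sub>m\<^sub>a\<^sub>x z dz L\<^sub>f L\<^sub>h \<longleftrightarrow>
     L\<^sub>f > 0 \<and> L\<^sub>h > 0 \<and>
     (\<exists>S. bounded S \<and> convex S
        \<and> (\<forall>k. \<forall>s\<in>{0..t\<^sub>m\<^sub>a\<^sub>x}. z k + s *\<^sub>R dz k \<in> S)
        \<and> L\<^sub>f-lipschitz_on S (grad f) \<and> L\<^sub>h-lipschitz_on S (grad h))"

text \<open>
  \<^const>\<open>Least\<close> on the reals is an attained minimum: the definition below carries
  information only if \<open>f\<close> has a minimizer on the sublevel set.
\<close>

definition f_star :: "('a \<Rightarrow> real) \<Rightarrow> ('a \<Rightarrow> real) \<Rightarrow> real \<Rightarrow> real" where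
  "f_star f h \<epsilon> = (LEAST v. v \<in> f ` {z. h z \<le> \<epsilon>\<^sup>2})"

definition t_min :: "real \<Rightarrow> real \<Rightarrow> real \<Rightarrow> real \<Rightarrow> real \<Rightarrow> real \<Rightarrow> real \<Rightarrow> real \<Rightarrow> real" where
  "t_min \<alpha>\<^sub>b w t\<^sub>m\<^sub>a\<^sub>x \<beta> \<alpha>\<^sub>l\<^sub>s \<gamma> L\<^sub>f L\<^sub>h =
     Min {\<beta> * (2 * (1 - \<alpha>\<^sub>l\<^sub>s) / L\<^sub>f), \<beta> * (\<gamma> / \<alpha>\<^sub>b), \<beta> * (2 * w / L\<^sub>h), t\<^sub>m\<^sub>a\<^sub>x}"

end

theory Submission
  imports Defs
begin

text \<open>
  The step 0 and all scalings \<open>s *\<^sub>R \<Delta>z\<close> with \<open>s \<in> [0, 1]\<close> are feasible for the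
  subproblem, so optimality along the segment from 0 to \<open>\<Delta>z\<close> gives
  \<open>\<nabla>f \<bullet> \<Delta>z \<le> - \<parallel>\<Delta>z\<parallel>\<^sup>2\<close> without any constraint qualification. With the descent lemma for
  \<open>f\<close> and \<open>h\<close>, both line search conditions hold for every step below an explicit threshold, so
  backtracking never goes under \<open>t_min\<close>, and the Armijo decrease telescopes. For the limit, the
  iterates stay in the compact sublevel set of \<open>h\<close> and \<open>\<parallel>\<Delta>z\<parallel> \<le> \<parallel>\<nabla>f\<parallel>\<close>, so all trial points lie
  in one ball, on which \<open>\<nabla>f\<close> and
  \<open>\<nabla>h = 2 [\<nabla>\<^sub>y\<^sub>x\<^sup>2 g  \<nabla>\<^sub>y\<^sub>y\<^sup>2 g]\<^sup>T \<nabla>\<^sub>y g\<close> are Lipschitz continuous.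
\<close>

section \<open>Gradients and Lipschitz continuity\<close>

text \<open>The vector with coordinates \<open>f' b\<close> in the orthonormal basis represents the
  derivative. Since \<open>grad\<close> is a definite description, this existence is what gives
  \<open>grad f x\<close> its meaning.\<close>

lemma GDERIV_grad:
  fixes f :: "'a::euclidean_space \<Rightarrow> real"
  assumes "(f has_derivative f') (at x)"
  shows "GDERIV f x :> grad f x" and "v \<bullet> grad f x = f' v"
proof -
  interpret f': bounded_linear f'
    using assms by (rule has_derivative_bounded_linear)
  let ?D = "\<Sum>b\<in>Basis. f' b *\<^sub>R b"
  have *: "v \<bullet> ?D = f' v" for v
  proof -
    have "f' v = f' (\<Sum>b\<in>Basis. (v \<bullet> b) *\<^sub>R b)"
      by (simp add: euclidean_representation)
    then show ?thesis
      by (simp add: f'.sum f'.scaleR inner_sum_right mult.commute)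
  qed
  have D: "GDERIV f x :> ?D"
    using assms by (simp add: gderiv_def * )
  then have "grad f x = ?D"
    by (rule grad_eqI)
  with D * show "GDERIV f x :> grad f x" and "v \<bullet> grad f x = f' v"
    by simp_all
qed

text \<open>At parameter \<open>u\<close> the derivative of \<open>F\<close> along the segment
  exceeds its initial value by at most \<open>L * u * (norm d)\<^sup>2\<close>. Monotonicity of the
  auxiliary function \<open>\<phi>\<close> replaces integration of this bound.\<close>

lemma descent_lemma:
  fixes F :: "'a::euclidean_space \<Rightarrow> real"
  assumes diff: "\<And>p. GDERIV F p :> grad F p"
    and lip: "L-lipschitz_on S (grad F)"
    and seg: "\<And>u. 0 \<le> u \<Longrightarrow> u \<le> s \<Longrightarrow> x + u *\<^sub>R d \<in> S"
    and "0 \<le> s"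
  shows "F (x + s *\<^sub>R d) \<le> F x + s * (grad F x \<bullet> d) + L / 2 * s\<^sup>2 * (norm d)\<^sup>2"
proof -
  define \<phi> where "\<phi> u = F (x + u *\<^sub>R d) - u * (grad F x \<bullet> d) - L / 2 * u\<^sup>2 * (norm d)\<^sup>2" for u
  have "\<phi> s \<le> \<phi> 0"
  proof (rule DERIV_nonpos_imp_nonincreasing[OF \<open>0 \<le> s\<close>])
    fix u assume u: "0 \<le> u" "u \<le> s"
    have "(F has_derivative (\<lambda>v. v \<bullet> grad F (x + u *\<^sub>R d))) (at (x + u *\<^sub>R d))"
      using diff unfolding gderiv_def .
    moreover have "((\<lambda>u. x + u *\<^sub>R d) has_derivative (\<lambda>v. v *\<^sub>R d)) (at u)"
      by (auto intro!: derivative_eq_intros)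
    ultimately have "((\<lambda>u. F (x + u *\<^sub>R d)) has_derivative (\<lambda>v. (v *\<^sub>R d) \<bullet> grad F (x + u *\<^sub>R d))) (at u)"
      by (rule has_derivative_compose[rotated])
    then have "DERIV (\<lambda>u. F (x + u *\<^sub>R d)) u :> grad F (x + u *\<^sub>R d) \<bullet> d"
      by (rule has_derivative_imp_has_field_derivative) (simp add: inner_commute)
    then have "DERIV \<phi> u :> grad F (x + u *\<^sub>R d) \<bullet> d - grad F x \<bullet> d - L * u * (norm d)\<^sup>2"
      unfolding \<phi>_def by (auto intro!: derivative_eq_intros)
    moreover have "grad F (x + u *\<^sub>R d) \<bullet> d - grad F x \<bullet> d \<le> L * u * (norm d)\<^sup>2"
    proof -
      have "norm (grad F (x + u *\<^sub>R d) - grad F x) \<le> L * norm (u *\<^sub>R d)"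
        using lipschitz_on_normD[OF lip seg[OF u] seg[of 0]] \<open>0 \<le> s\<close> by simp
      then have "norm (grad F (x + u *\<^sub>R d) - grad F x) * norm d \<le> L * norm (u *\<^sub>R d) * norm d"
        by (rule mult_right_mono) simp
      moreover have "(grad F (x + u *\<^sub>R d) - grad F x) \<bullet> d
          \<le> norm (grad F (x + u *\<^sub>R d) - grad F x) * norm d"
        by (rule norm_cauchy_schwarz)
      ultimately show ?thesis
        using u by (simp add: inner_diff_left power2_eq_square mult.assoc)
    qed
    ultimately show "\<exists>y. DERIV \<phi> u :> y \<and> y \<le> 0"
      by (intro exI conjI) auto
  qed
  then show ?thesis
    by (simp add: \<phi>_def)
qed

text \<open>Compactness merges the local constants into one; the parameter set \<open>{0}\<close> is
  compact and the family is constant in the parameter, which settles the side conditions of the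
  library result.\<close>

lemma locally_lipschitz_on_compact:
  assumes "locally_lipschitz F" and "compact S"
  obtains L where "L-lipschitz_on S F"
proof -
  have "local_lipschitz {0::real} S (\<lambda>_. F)"
    using assms(1) unfolding locally_lipschitz_def by (rule local_lipschitz_subset) auto
  from local_lipschitz_compact_implies_lipschitz[OF this \<open>compact S\<close>]
  show ?thesis
    using that by (metis compact_sing continuous_on_const insertI1)
qed

lemma lipschitz_on_bounded_image:
  assumes F: "L-lipschitz_on S F" and "bounded S"
  shows "bounded (F ` S)"
proof (cases "S = {}")
  case False
  then obtain x where x: "x \<in> S"
    by blast
  with \<open>bounded S\<close> obtain e where e: "\<And>y. y \<in> S \<Longrightarrow> dist x y \<le> e"
    unfolding bounded_any_center[where a = x] by blast
  have "dist (F x) (F y) \<le> L * e" if "y \<in> S" for y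
    using lipschitz_onD[OF F x that] mult_left_mono[OF e[OF that] lipschitz_on_nonneg[OF F]]
    by (rule order_trans)
  then show ?thesis
    unfolding bounded_def by blast
qed simp

text \<open>Both factors are bounded on the bounded set \<open>S\<close>, so each half of the split
  difference is controlled by one Lipschitz constant and one bound.\<close>

lemma (in bounded_bilinear) lipschitz_on_prod:
  assumes F: "L-lipschitz_on S F" and G: "M-lipschitz_on S G" and S: "bounded S"
  obtains K where "K-lipschitz_on S (\<lambda>x. prod (F x) (G x))"
proof -
  obtain C where C: "0 < C" "\<And>a b. norm (prod a b) \<le> norm a * norm b * C"
    using pos_bounded by blast
  have "bounded (F ` S)" "bounded (G ` S)"
    using lipschitz_on_bounded_image[OF F S] lipschitz_on_bounded_image[OF G S] .
  then obtain A B where A: "0 < A" "\<And>x. x \<in> S \<Longrightarrow> norm (F x) \<le> A"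
    and B: "0 < B" "\<And>x. x \<in> S \<Longrightarrow> norm (G x) \<le> B"
    unfolding bounded_pos by blast
  have L: "0 \<le> L" and M: "0 \<le> M"
    using F G by (auto dest: lipschitz_on_nonneg)
  have "((A * M + L * B) * C)-lipschitz_on S (\<lambda>x. prod (F x) (G x))"
  proof (rule lipschitz_onI)
    fix x y assume xy: "x \<in> S" "y \<in> S"
    \<comment> \<open>The mixed term \<open>prod (F x) (G y)\<close> is subtracted and
      added.\<close>
    have "prod (F x) (G x) - prod (F y) (G y) = prod (F x) (G x - G y) + prod (F x - F y) (G y)"
      by (simp add: diff_left diff_right)
    then have "dist (prod (F x) (G x)) (prod (F y) (G y))
        \<le> norm (prod (F x) (G x - G y)) + norm (prod (F x - F y) (G y))"
      by (simp add: dist_norm norm_triangle_ineq)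
    also have "\<dots> \<le> norm (F x) * norm (G x - G y) * C + norm (F x - F y) * norm (G y) * C"
      by (intro add_mono C)
    also have "\<dots> \<le> A * (M * dist x y) * C + (L * dist x y) * B * C"
      using A B C L M lipschitz_onD[OF F xy] lipschitz_onD[OF G xy] xy
      by (intro add_mono mult_mono) (auto simp: dist_norm)
    also have "\<dots> = (A * M + L * B) * C * dist x y"
      by (simp add: algebra_simps)
    finally show "dist (prod (F x) (G x)) (prod (F y) (G y)) \<le> (A * M + L * B) * C * dist x y" .
  qed (use A B C L M in simp)
  then show ?thesis
    by (rule that)
qed

lemma bounded_bilinear_vector_matrix_mult:
  "bounded_bilinear ((v*) :: real^'m \<Rightarrow> real^'n^'m \<Rightarrow> real^'n)"
proof -
  have "bilinear ((v*) :: real^'m \<Rightarrow> real^'n^'m \<Rightarrow> real^'n)"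
    unfolding bilinear_def
    by (auto intro!: linearI
        simp: vec_eq_iff vector_matrix_mult_def sum.distrib sum_distrib_left algebra_simps)
  then show ?thesis
    by (simp add: bilinear_conv_bounded_bilinear)
qed

text \<open>The operator norm of the derivative is bounded on the compact set, and convexity gives
  the mean value inequality.\<close>

lemma C1_lipschitz_on_compact:
  fixes F :: "'a::euclidean_space \<Rightarrow> 'b::real_normed_vector"
  assumes F: "continuously_differentiable F" and S: "compact S" "convex S"
  obtains L where "L-lipschitz_on S F"
proof -
  obtain F' :: "'a \<Rightarrow> 'a \<Rightarrow>\<^sub>L 'b" where F': "\<And>z. (F has_derivative blinfun_apply (F' z)) (at z)"
    and cont: "continuous_on UNIV F'"
    using F unfolding continuously_differentiable_def by blast
  have "compact (F' ` S)"
    using cont S by (intro compact_continuous_image) (auto intro: continuous_on_subset)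
  then obtain B where B: "0 < B" "\<And>x. x \<in> S \<Longrightarrow> norm (F' x) \<le> B"
    by (auto dest!: compact_imp_bounded simp: bounded_pos)
  have "B-lipschitz_on S F"
    using B F' S by (intro bounded_derivative_imp_lipschitz[where f' = "\<lambda>x. blinfun_apply (F' x)"])
      (auto simp: norm_blinfun.rep_eq[symmetric] intro: has_derivative_at_withinI)
  then show ?thesis
    by (rule that)
qed

section \<open>The squared norm of the partial gradient\<close>

text \<open>\<open>grad_y g\<close> is a fixed bounded linear map applied to the full derivative of
  \<open>g\<close>, so it inherits the continuous differentiability of that derivative.\<close>

lemma grad_y_continuously_differentiable:
  fixes g :: "(real^'n) \<times> (real^'m) \<Rightarrow> real"
  assumes "twice_continuously_differentiable g"
  shows "continuously_differentiable (grad_y g)"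
proof -
  obtain g' where g': "\<And>z. (g has_derivative blinfun_apply (g' z)) (at z)"
    and "continuously_differentiable g'"
    using assms unfolding twice_continuously_differentiable_def by blast
  then obtain g'' where g'': "\<And>z. (g' has_derivative blinfun_apply (g'' z)) (at z)"
    and cont: "continuous_on UNIV g''"
    unfolding continuously_differentiable_def by blast
  \<comment> \<open>\<open>\<Lambda>\<close> restricts a functional to the directions
    \<open>(0, b)\<close> and returns the vector representing the restriction.\<close>
  define \<Lambda> :: "(((real^'n) \<times> (real^'m)) \<Rightarrow>\<^sub>L real) \<Rightarrow> real^'m"
    where "\<Lambda> A = (\<Sum>b\<in>Basis. blinfun_apply A (0, b) *\<^sub>R b)" for A
  have \<Lambda>: "bounded_linear \<Lambda>"
    unfolding \<Lambda>_def by (intro bounded_linear_intros)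
  have eq: "grad_y g = (\<lambda>z. \<Lambda> (g' z))"
  proof
    fix z :: "(real^'n) \<times> (real^'m)"
    have "((\<lambda>y. (fst z, y)) has_derivative (\<lambda>v. (0, v))) (at (snd z))"
      by (auto intro!: derivative_eq_intros)
    then have "((\<lambda>y. g (fst z, y)) has_derivative (\<lambda>v. g' z (0, v))) (at (snd z))"
      by (rule has_derivative_compose) (use g'[of z] in simp)
    from GDERIV_grad(2)[OF this] have "grad_y g z \<bullet> v = g' z (0, v)" for v
      by (simp add: grad_y_def inner_commute)
    then show "grad_y g z = \<Lambda> (g' z)"
      unfolding \<Lambda>_def by (metis (no_types, lifting) euclidean_representation sum.cong)
  qed
  have "(grad_y g has_derivative blinfun_apply (Blinfun \<Lambda> o\<^sub>L g'' z)) (at z)" for z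
    unfolding eq blinfun_compose.rep_eq bounded_linear_Blinfun_apply[OF \<Lambda>] o_def
    by (rule bounded_linear.has_derivative[OF \<Lambda> g''])
  moreover have "continuous_on UNIV (\<lambda>z. Blinfun \<Lambda> o\<^sub>L g'' z)"
    using cont by (intro continuous_intros)
  ultimately show ?thesis
    unfolding continuously_differentiable_def by (intro exI conjI allI)
qed

text \<open>The Hessian blocks are Jacobians along the two coordinate slices. The total derivative
  restricted to a slice is a derivative there too, so uniqueness identifies it with the block;
  additivity joins the two.\<close>

lemma grad_y_has_derivative_hess:
  fixes g :: "(real^'n) \<times> (real^'m) \<Rightarrow> real"
  assumes "continuously_differentiable (grad_y g)"
  shows "(grad_y g has_derivative (\<lambda>v. hess_yx g z *v fst v + hess_yy g z *v snd v)) (at z)"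
proof -
  obtain G where G: "(grad_y g has_derivative blinfun_apply G) (at z)"
    using assms unfolding continuously_differentiable_def by blast
  have "((\<lambda>x. (x, snd z)) has_derivative (\<lambda>v. (v, 0))) (at (fst z))"
    by (auto intro!: derivative_eq_intros)
  then have x: "((\<lambda>x. grad_y g (x, snd z)) has_derivative (\<lambda>v. G (v, 0))) (at (fst z))"
    by (rule has_derivative_compose) (use G in simp)
  then have "((\<lambda>x. grad_y g (x, snd z)) has_derivative (*v) (hess_yx g z)) (at (fst z))"
    unfolding hess_yx_def jacobian_works[symmetric] by (rule differentiableI)
  from has_derivative_unique[OF x this] have yx: "G (v, 0) = hess_yx g z *v v" for v
    by metis
  have "((\<lambda>y. (fst z, y)) has_derivative (\<lambda>v. (0, v))) (at (snd z))"
    by (auto intro!: derivative_eq_intros)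
  then have y: "((\<lambda>y. grad_y g (fst z, y)) has_derivative (\<lambda>v. G (0, v))) (at (snd z))"
    by (rule has_derivative_compose) (use G in simp)
  then have "((\<lambda>y. grad_y g (fst z, y)) has_derivative (*v) (hess_yy g z)) (at (snd z))"
    unfolding hess_yy_def jacobian_works[symmetric] by (rule differentiableI)
  from has_derivative_unique[OF y this] have yy: "G (0, v) = hess_yy g z *v v" for v
    by metis
  have "G v = hess_yx g z *v fst v + hess_yy g z *v snd v" for v
  proof -
    have "G v = G ((fst v, 0) + (0, snd v))"
      by simp
    also have "\<dots> = G (fst v, 0) + G (0, snd v)"
      by (rule blinfun.add_right)
    finally show ?thesis
      by (simp add: yx yy)
  qed
  then have "blinfun_apply G = (\<lambda>v. hess_yx g z *v fst v + hess_yy g z *v snd v)"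
    by (rule ext)
  with G show ?thesis
    by simp
qed

text \<open>The product rule gives twice the inner product of the partial gradient with its
  derivative; moving the matrices to the other side makes them act as transposes.\<close>

lemma GDERIV_norm_grad_y_squared:
  fixes g :: "(real^'n) \<times> (real^'m) \<Rightarrow> real"
  assumes "continuously_differentiable (grad_y g)"
  shows "GDERIV (\<lambda>p. (norm (grad_y g p))\<^sup>2) z :>
    2 *\<^sub>R (grad_y g z v* hess_yx g z, grad_y g z v* hess_yy g z)"
proof -
  let ?G = "grad_y g z" and ?H = "\<lambda>v. hess_yx g z *v fst v + hess_yy g z *v snd v"
  have "((\<lambda>p. (norm (grad_y g p))\<^sup>2) has_derivative (\<lambda>v. ?G \<bullet> ?H v + ?H v \<bullet> ?G)) (at z)"
    unfolding power2_norm_eq_inner using grad_y_has_derivative_hess[OF assms]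
    by (intro has_derivative_inner)
  moreover have "?G \<bullet> ?H v + ?H v \<bullet> ?G = v \<bullet> 2 *\<^sub>R (?G v* hess_yx g z, ?G v* hess_yy g z)" for v
  proof -
    have "(?G v* hess_yx g z, ?G v* hess_yy g z) \<bullet> v = ?G \<bullet> ?H v"
      by (simp add: inner_prod_def dot_lmul_matrix inner_add_right)
    then show ?thesis
      by (simp only: inner_scaleR_right inner_commute[of v] inner_commute[of "?H v"])
  qed
  ultimately show ?thesis
    by (simp only: gderiv_def)
qed

text \<open>Each component of the explicit gradient is a product of \<open>grad_y g\<close>,
  Lipschitz as a C1 map on a compact convex set, with a locally Lipschitz Hessian block.\<close>

lemma grad_norm_grad_y_squared_lipschitz_on_compact:
  fixes g :: "(real^'n) \<times> (real^'m) \<Rightarrow> real"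
  assumes C1: "continuously_differentiable (grad_y g)"
    and hess: "locally_lipschitz (hess_yx g)" "locally_lipschitz (hess_yy g)"
    and S: "compact S" "convex S"
  obtains L where "L-lipschitz_on S (grad (\<lambda>p. (norm (grad_y g p))\<^sup>2))"
proof -
  obtain L0 where L0: "L0-lipschitz_on S (grad_y g)"
    using C1_lipschitz_on_compact[OF C1 S] .
  obtain L1 where L1: "L1-lipschitz_on S (hess_yx g)"
    using locally_lipschitz_on_compact[OF hess(1) S(1)] .
  obtain K1 where K1: "K1-lipschitz_on S (\<lambda>z. grad_y g z v* hess_yx g z)"
    using bounded_bilinear.lipschitz_on_prod[OF bounded_bilinear_vector_matrix_mult L0 L1
      compact_imp_bounded[OF S(1)]] .
  obtain L2 where L2: "L2-lipschitz_on S (hess_yy g)"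
    using locally_lipschitz_on_compact[OF hess(2) S(1)] .
  obtain K2 where K2: "K2-lipschitz_on S (\<lambda>z. grad_y g z v* hess_yy g z)"
    using bounded_bilinear.lipschitz_on_prod[OF bounded_bilinear_vector_matrix_mult L0 L2
      compact_imp_bounded[OF S(1)]] .
  have "grad (\<lambda>p. (norm (grad_y g p))\<^sup>2)
      = (\<lambda>z. 2 *\<^sub>R (grad_y g z v* hess_yx g z, grad_y g z v* hess_yy g z))"
    using grad_eqI[OF GDERIV_norm_grad_y_squared[OF C1]] by (rule ext)
  with lipschitz_on_cmult[OF lipschitz_on_Pair[OF K1 K2], of 2] show ?thesis
    by (intro that) simp
qed

section \<open>One step of the algorithm\<close>

text \<open>Minimizing the objective means minimizing the distance to \<open>- grad f z\<close>.
  Hence \<open>d\<close> is the nearest point to it on the segment from 0 to \<open>d\<close>, and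
  the variational inequality tested at 0 is the claim.\<close>

lemma qp_solution_descent:
  assumes opt: "is_arg_min (qp_objective f z) (qp_feasible h \<epsilon> \<alpha>\<^sub>b w z) d"
    and "h z \<le> \<epsilon>\<^sup>2" "0 \<le> \<alpha>\<^sub>b" "0 \<le> w"
  shows "grad f z \<bullet> d \<le> - (norm d)\<^sup>2"
proof -
  have c: "\<alpha>\<^sub>b * (h z - \<epsilon>\<^sup>2) \<le> 0"
    using assms by (simp add: mult_nonneg_nonpos)
  have feas: "grad h z \<bullet> d + \<alpha>\<^sub>b * (h z - \<epsilon>\<^sup>2) + w * (norm d)\<^sup>2 \<le> 0"
    using opt by (simp add: is_arg_min_def qp_feasible_def)
  have "dist (- grad f z) d \<le> dist (- grad f z) x" if "x \<in> closed_segment 0 d" for x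
  proof -
    from that obtain s where s: "0 \<le> s" "s \<le> 1" and x: "x = s *\<^sub>R d"
      by (auto simp: in_segment)
    \<comment> \<open>The constraint at \<open>x\<close> is a sum of three nonpositive terms:
      \<open>s\<close> times the constraint at \<open>d\<close>, \<open>1 - s\<close> times its
      constant term, and the gain from \<open>s\<^sup>2 \<le> s\<close> in the quadratic
      term.\<close>
    have "s\<^sup>2 * (w * (norm d)\<^sup>2) \<le> s * (w * (norm d)\<^sup>2)"
      using s \<open>0 \<le> w\<close> by (intro mult_right_mono) (simp_all add: power2_eq_square mult_left_le)
    moreover have "s * (grad h z \<bullet> d + \<alpha>\<^sub>b * (h z - \<epsilon>\<^sup>2) + w * (norm d)\<^sup>2) \<le> 0"
      using s feas by (simp add: mult_nonneg_nonpos)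
    moreover have "(1 - s) * (\<alpha>\<^sub>b * (h z - \<epsilon>\<^sup>2)) \<le> 0"
      using s c by (simp add: mult_nonneg_nonpos)
    ultimately have "qp_feasible h \<epsilon> \<alpha>\<^sub>b w z x"
      by (simp add: qp_feasible_def x power_mult_distrib algebra_simps)
    then have "qp_objective f z d \<le> qp_objective f z x"
      using opt by (auto simp: is_arg_min_def not_less)
    then have "norm (d + grad f z) \<le> norm (x + grad f z)"
      by (simp add: qp_objective_def)
    then show ?thesis
      by (simp add: dist_norm norm_minus_commute[of "- grad f z"])
  qed
  then have "(- grad f z - d) \<bullet> (0 - d) \<le> 0"
    by (intro any_closest_point_dot[where S = "closed_segment 0 d"]) auto
  then show ?thesis
    by (simp add: inner_diff_left inner_minus_left power2_norm_eq_inner)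
qed

text \<open>The quadratic remainder is at most \<open>s * (1 - \<alpha>) * (norm d)\<^sup>2\<close>;
  by \<open>desc\<close> it costs at most the fraction \<open>1 - \<alpha>\<close> of the predicted
  decrease, leaving the fraction \<open>\<alpha>\<close>.\<close>

lemma armijo_short_step:
  assumes diff: "\<And>p. GDERIV f p :> grad f p"
    and lip: "L-lipschitz_on S (grad f)" "0 < L"
    and seg: "\<And>u. 0 \<le> u \<Longrightarrow> u \<le> s \<Longrightarrow> z + u *\<^sub>R d \<in> S"
    and s: "0 \<le> s" "s \<le> 2 * (1 - \<alpha>) / L"
    and desc: "grad f z \<bullet> d \<le> - (norm d)\<^sup>2"
  shows "armijo f \<alpha> z d s"
proof -
  have "s * L / 2 \<le> 1 - \<alpha>"
    using s \<open>0 < L\<close> by (simp add: field_simps)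
  moreover have "0 \<le> s * L / 2"
    using s \<open>0 < L\<close> by simp
  ultimately have "0 \<le> 1 - \<alpha>"
    by linarith
  have "s * (s * L / 2) * (norm d)\<^sup>2 \<le> s * (1 - \<alpha>) * (norm d)\<^sup>2"
    using s(1) \<open>s * L / 2 \<le> 1 - \<alpha>\<close> by (intro mult_right_mono mult_left_mono) simp_all
  moreover have "s * (1 - \<alpha>) * (norm d)\<^sup>2 \<le> s * (1 - \<alpha>) * - (grad f z \<bullet> d)"
    using desc \<open>0 \<le> s\<close> \<open>0 \<le> 1 - \<alpha>\<close> by (intro mult_left_mono mult_nonneg_nonneg) simp_all
  moreover have "f (z + s *\<^sub>R d) \<le> f z + s * (grad f z \<bullet> d) + L / 2 * s\<^sup>2 * (norm d)\<^sup>2"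
    using diff lip(1) seg s(1) by (rule descent_lemma)
  ultimately show ?thesis
    by (simp add: armijo_def power2_eq_square algebra_simps)
qed

text \<open>The margin \<open>w * (norm d)\<^sup>2\<close> in the constraint absorbs the quadratic
  remainder, leaving the factor \<open>1 - s * \<alpha>\<^sub>b\<close> on
  \<open>h z - \<epsilon>\<^sup>2\<close>. As this difference is nonpositive,
  \<open>s * \<alpha>\<^sub>b \<le> \<gamma>\<close> suffices.\<close>

lemma safety_short_step:
  assumes diff: "\<And>p. GDERIV h p :> grad h p"
    and lip: "L-lipschitz_on S (grad h)" "0 < L"
    and seg: "\<And>u. 0 \<le> u \<Longrightarrow> u \<le> s \<Longrightarrow> z + u *\<^sub>R d \<in> S"
    and s: "0 \<le> s" "s \<le> \<gamma> / \<alpha>\<^sub>b" "s \<le> 2 * w / L" and "0 < \<alpha>\<^sub>b"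
    and feas: "qp_feasible h \<epsilon> \<alpha>\<^sub>b w z d" and "h z \<le> \<epsilon>\<^sup>2"
  shows "safety h \<epsilon> \<gamma> z d s"
proof -
  have "s * \<alpha>\<^sub>b \<le> \<gamma>" "s * L / 2 \<le> w"
    using s \<open>0 < L\<close> \<open>0 < \<alpha>\<^sub>b\<close> by (simp_all add: field_simps)
  then have "s * (s * L / 2) * (norm d)\<^sup>2 \<le> s * w * (norm d)\<^sup>2"
    using s by (intro mult_right_mono mult_left_mono) auto
  moreover have "(\<gamma> - s * \<alpha>\<^sub>b) * (h z - \<epsilon>\<^sup>2) \<le> 0"
    using \<open>s * \<alpha>\<^sub>b \<le> \<gamma>\<close> \<open>h z \<le> \<epsilon>\<^sup>2\<close> by (simp add: mult_nonneg_nonpos)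
  moreover have "s * (grad h z \<bullet> d + \<alpha>\<^sub>b * (h z - \<epsilon>\<^sup>2)) \<le> s * (- w * (norm d)\<^sup>2)"
    using feas s(1) unfolding qp_feasible_def by (rule mult_left_mono)
  moreover have "h (z + s *\<^sub>R d) \<le> h z + s * (grad h z \<bullet> d) + L / 2 * s\<^sup>2 * (norm d)\<^sup>2"
    using diff lip(1) seg s(1) by (rule descent_lemma)
  ultimately show ?thesis
    by (simp add: safety_def power2_eq_square algebra_simps)
qed

text \<open>Either the first trial is accepted, or the trial just before the accepted one failed and
  so exceeded \<open>c\<close>; the accepted step is smaller by one factor
  \<open>\<beta>\<close>.\<close>

lemma first_backtrack_lower_bound:
  assumes t: "first_backtrack t\<^sub>m\<^sub>a\<^sub>x \<beta> P t" and "0 < \<beta>" "\<beta> < 1" "0 < t\<^sub>m\<^sub>a\<^sub>x"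
    and P: "\<And>s. 0 < s \<Longrightarrow> s \<le> t\<^sub>m\<^sub>a\<^sub>x \<Longrightarrow> s \<le> c \<Longrightarrow> P s"
  shows "min (\<beta> * c) t\<^sub>m\<^sub>a\<^sub>x \<le> t"
proof -
  obtain j where j: "t = \<beta> ^ j * t\<^sub>m\<^sub>a\<^sub>x" "\<And>i. i < j \<Longrightarrow> \<not> P (\<beta> ^ i * t\<^sub>m\<^sub>a\<^sub>x)"
    using t unfolding first_backtrack_def by blast
  show ?thesis
  proof (cases j)
    case 0
    with j show ?thesis by simp
  next
    case (Suc i)
    have "\<beta> ^ i \<le> 1"
      using \<open>0 < \<beta>\<close> \<open>\<beta> < 1\<close> by (simp add: power_le_one)
    then have "\<not> \<beta> ^ i * t\<^sub>m\<^sub>a\<^sub>x \<le> c"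
      using j(2)[of i] P[of "\<beta> ^ i * t\<^sub>m\<^sub>a\<^sub>x"] Suc \<open>0 < \<beta>\<close> \<open>0 < t\<^sub>m\<^sub>a\<^sub>x\<close> by auto
    then have "\<beta> * c \<le> \<beta> * (\<beta> ^ i * t\<^sub>m\<^sub>a\<^sub>x)"
      using \<open>0 < \<beta>\<close> by simp
    with j Suc show ?thesis by (simp add: mult.assoc)
  qed
qed

text \<open>Pulling out \<open>\<beta>\<close> exposes the common threshold of both line search
  conditions, in the shape of \<open>first_backtrack_lower_bound\<close>.\<close>

lemma t_min_eq:
  assumes "0 < \<beta>"
  shows "t_min \<alpha>\<^sub>b w t\<^sub>m\<^sub>a\<^sub>x \<beta> \<alpha>\<^sub>l\<^sub>s \<gamma> L\<^sub>f L\<^sub>h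
    = min (\<beta> * min (2 * (1 - \<alpha>\<^sub>l\<^sub>s) / L\<^sub>f) (min (\<gamma> / \<alpha>\<^sub>b) (2 * w / L\<^sub>h))) t\<^sub>m\<^sub>a\<^sub>x"
  using assms by (simp add: t_min_def min_mult_distrib_left min.assoc)

section \<open>Convergence\<close>

lemma sublevel_compact:
  fixes h :: "'a::euclidean_space \<Rightarrow> real"
  assumes "filterlim h at_top at_infinity" and "continuous_on UNIV h"
  shows "compact {p. h p \<le> c}"
proof -
  have "eventually (\<lambda>p. c < h p) at_infinity"
    using assms(1) by (simp add: filterlim_at_top_dense)
  then obtain b where "\<And>p. b \<le> norm p \<Longrightarrow> c < h p"
    by (auto simp: eventually_at_infinity)
  then have "bounded {p. h p \<le> c}"
    by (intro boundedI[of _ b]) (force simp: not_le[symmetric])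
  moreover have "closed {p. h p \<le> c}"
    using assms(2) by (intro closed_Collect_le continuous_on_const)
  ultimately show ?thesis
    by (simp add: compact_eq_bounded_closed)
qed

text \<open>The sublevel set is compact, and nonempty because it contains \<open>p\<close>, so
  \<open>f\<close> has a minimizer there and the \<open>LEAST\<close> in \<open>f_star\<close> is
  its value.\<close>

lemma f_star_le:
  fixes f :: "'a::topological_space \<Rightarrow> real"
  assumes "compact {p. h p \<le> \<epsilon>\<^sup>2}" and "continuous_on UNIV f" and "h p \<le> \<epsilon>\<^sup>2"
  shows "f_star f h \<epsilon> \<le> f p"
proof -
  obtain q where q: "h q \<le> \<epsilon>\<^sup>2" "\<And>p. h p \<le> \<epsilon>\<^sup>2 \<Longrightarrow> f q \<le> f p"
    using continuous_attains_inf[OF assms(1), of f] assms(2,3)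
    by (auto intro: continuous_on_subset)
  then have "f_star f h \<epsilon> = f q"
    unfolding f_star_def by (intro Least_equality) auto
  with q assms(3) show ?thesis by simp
qed

text \<open>The Armijo decrease with steps bounded below telescopes. Leaving the sum undivided lets
  one estimate serve both the average bound and summability.\<close>

lemma average_step_bound:
  fixes f h :: "'a::euclidean_space \<Rightarrow> real"
  assumes f: "\<And>p. GDERIV f p :> grad f p" and h: "\<And>p. GDERIV h p :> grad h p"
    and star: "\<And>k. f_star f h \<epsilon> \<le> f (z k)"
    and pos: "\<alpha>\<^sub>b > 0" "w > 0" "t\<^sub>m\<^sub>a\<^sub>x > 0"
    and unit_interval: "\<beta> \<in> {0<..<1}" "\<alpha>\<^sub>l\<^sub>s \<in> {0<..<1}" "\<gamma> \<in> {0<..<1}"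
    and safe: "\<And>k. h (z k) \<le> \<epsilon>\<^sup>2"
    and alg: "generated_by_algorithm f h \<epsilon> \<alpha>\<^sub>b w t\<^sub>m\<^sub>a\<^sub>x \<beta> \<alpha>\<^sub>l\<^sub>s \<gamma> z dz t"
    and lip: "uniform_lipschitz_constants f h t\<^sub>m\<^sub>a\<^sub>x z dz L\<^sub>f L\<^sub>h"
  shows "0 < t_min \<alpha>\<^sub>b w t\<^sub>m\<^sub>a\<^sub>x \<beta> \<alpha>\<^sub>l\<^sub>s \<gamma> L\<^sub>f L\<^sub>h"
    and "\<alpha>\<^sub>l\<^sub>s * t_min \<alpha>\<^sub>b w t\<^sub>m\<^sub>a\<^sub>x \<beta> \<alpha>\<^sub>l\<^sub>s \<gamma> L\<^sub>f L\<^sub>h * (\<Sum>k<K. (norm (dz k))\<^sup>2) \<le> f (z 0) - f_star f h \<epsilon>"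
proof -
  let ?t = "t_min \<alpha>\<^sub>b w t\<^sub>m\<^sub>a\<^sub>x \<beta> \<alpha>\<^sub>l\<^sub>s \<gamma> L\<^sub>f L\<^sub>h"
  \<comment> \<open>The first entry is the threshold for the Armijo condition, the other two are
    those for safety.\<close>
  let ?c = "min (2 * (1 - \<alpha>\<^sub>l\<^sub>s) / L\<^sub>f) (min (\<gamma> / \<alpha>\<^sub>b) (2 * w / L\<^sub>h))"
  obtain S where L: "L\<^sub>f > 0" "L\<^sub>h > 0"
    and S: "\<forall>k. \<forall>s\<in>{0..t\<^sub>m\<^sub>a\<^sub>x}. z k + s *\<^sub>R dz k \<in> S"
    and Lf: "L\<^sub>f-lipschitz_on S (grad f)" and Lh: "L\<^sub>h-lipschitz_on S (grad h)"
    using lip unfolding uniform_lipschitz_constants_def by blast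
  have step: "z (Suc k) = z k + t k *\<^sub>R dz k"
    and qp: "is_arg_min (qp_objective f (z k)) (qp_feasible h \<epsilon> \<alpha>\<^sub>b w (z k)) (dz k)"
    and bt: "first_backtrack t\<^sub>m\<^sub>a\<^sub>x \<beta>
      (\<lambda>s. armijo f \<alpha>\<^sub>l\<^sub>s (z k) (dz k) s \<and> safety h \<epsilon> \<gamma> (z k) (dz k) s) (t k)" for k
    using alg unfolding generated_by_algorithm_def by auto
  show "0 < ?t"
    using pos unit_interval L by (simp add: t_min_eq)
  have decrease: "\<alpha>\<^sub>l\<^sub>s * ?t * (norm (dz k))\<^sup>2 \<le> f (z k) - f (z (Suc k))" for k
  proof -
    have desc: "grad f (z k) \<bullet> dz k \<le> - (norm (dz k))\<^sup>2"
      using qp_solution_descent[OF qp safe] pos by simp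
    have feas: "qp_feasible h \<epsilon> \<alpha>\<^sub>b w (z k) (dz k)"
      using qp by (simp add: is_arg_min_def)
    have "armijo f \<alpha>\<^sub>l\<^sub>s (z k) (dz k) s \<and> safety h \<epsilon> \<gamma> (z k) (dz k) s"
      if "0 < s" "s \<le> t\<^sub>m\<^sub>a\<^sub>x" "s \<le> ?c" for s
    proof
      show "armijo f \<alpha>\<^sub>l\<^sub>s (z k) (dz k) s"
        using that S by (intro armijo_short_step[OF f Lf L(1) _ _ _ desc]) auto
      show "safety h \<epsilon> \<gamma> (z k) (dz k) s"
        using that S by (intro safety_short_step[OF h Lh L(2) _ _ _ _ pos(1) feas safe]) auto
    qed
    then have "?t \<le> t k"
      using first_backtrack_lower_bound[OF bt, of ?c] pos unit_interval by (simp add: t_min_eq)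
    then have "\<alpha>\<^sub>l\<^sub>s * ?t * (norm (dz k))\<^sup>2 \<le> \<alpha>\<^sub>l\<^sub>s * t k * (norm (dz k))\<^sup>2"
      using unit_interval by (intro mult_right_mono) auto
    \<comment> \<open>The negated directional derivative dominates
      \<open>(norm (dz k))\<^sup>2\<close>, which links the Armijo decrease to the length of the
      direction.\<close>
    also have "\<dots> \<le> \<alpha>\<^sub>l\<^sub>s * t k * - (grad f (z k) \<bullet> dz k)"
      using desc unit_interval \<open>0 < ?t\<close> \<open>?t \<le> t k\<close> by (intro mult_left_mono) auto
    also have "\<dots> \<le> f (z k) - f (z (Suc k))"
      using bt[of k] by (auto simp: first_backtrack_def armijo_def step)
    finally show ?thesis .
  qed
  have "\<alpha>\<^sub>l\<^sub>s * ?t * (\<Sum>k<K. (norm (dz k))\<^sup>2) \<le> (\<Sum>k<K. f (z k) - f (z (Suc k)))"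
    unfolding sum_distrib_left by (intro sum_mono decrease)
  also have "\<dots> = f (z 0) - f (z K)"
    by (rule sum_lessThan_telescope')
  also have "\<dots> \<le> f (z 0) - f_star f h \<epsilon>"
    using star by simp
  finally show "\<alpha>\<^sub>l\<^sub>s * ?t * (\<Sum>k<K. (norm (dz k))\<^sup>2) \<le> f (z 0) - f_star f h \<epsilon>" .
qed

theorem theorem2:
  fixes f g h :: "(real^'n) \<times> (real^'m) \<Rightarrow> real"
    and \<epsilon> \<alpha>\<^sub>b w t\<^sub>m\<^sub>a\<^sub>x \<beta> \<alpha>\<^sub>l\<^sub>s \<gamma> :: real
    and z dz :: "nat \<Rightarrow> (real^'n) \<times> (real^'m)"
    and t :: "nat \<Rightarrow> real"
  assumes h_def: "\<And>p. h p = (norm (grad_y g p))\<^sup>2"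
    and A1: "continuously_differentiable f" "locally_lipschitz (grad f)"
    and A2: "twice_continuously_differentiable g"
            "locally_lipschitz (hess_yx g)" "locally_lipschitz (hess_yy g)"
    and A3: "\<And>p. grad_y g p \<noteq> 0 \<Longrightarrow>
               grad_y g p \<notin> null_space (transpose (hcat (hess_yx g p) (hess_yy g p)))"
    and A4: "filterlim h at_top at_infinity"
    and pos: "\<epsilon> > 0" "\<alpha>\<^sub>b > 0" "w > 0" "t\<^sub>m\<^sub>a\<^sub>x > 0"
    and unit_interval: "\<beta> \<in> {0<..<1}" "\<alpha>\<^sub>l\<^sub>s \<in> {0<..<1}" "\<gamma> \<in> {0<..<1}"
    and init: "h (z 0) \<le> \<epsilon>\<^sup>2"
    and alg: "generated_by_algorithm f h \<epsilon> \<alpha>\<^sub>b w t\<^sub>m\<^sub>a\<^sub>x \<beta> \<alpha>\<^sub>l\<^sub>s \<gamma> z dz t"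
  shows "(\<forall>K::nat. h (z K) - \<epsilon>\<^sup>2 \<le> (1 - \<gamma>) ^ K * (h (z 0) - \<epsilon>\<^sup>2)
                 \<and> (1 - \<gamma>) ^ K * (h (z 0) - \<epsilon>\<^sup>2) \<le> 0)
       \<and> (\<forall>L\<^sub>f L\<^sub>h. uniform_lipschitz_constants f h t\<^sub>m\<^sub>a\<^sub>x z dz L\<^sub>f L\<^sub>h \<longrightarrow>
            (\<forall>K\<ge>1. 1 / real K * (\<Sum>k<K. (norm (dz k))\<^sup>2)
                \<le> (f (z 0) - f_star f h \<epsilon>)
                   / (\<alpha>\<^sub>l\<^sub>s * t_min \<alpha>\<^sub>b w t\<^sub>m\<^sub>a\<^sub>x \<beta> \<alpha>\<^sub>l\<^sub>s \<gamma> L\<^sub>f L\<^sub>h * real K)))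
       \<and> (\<lambda>k. norm (dz k)) \<longlonglongrightarrow> 0"
proof -

  \<comment> \<open>Regularity of \<open>f\<close> and \<open>h\<close>, compactness of the sublevel
    set\<close>
  have f: "GDERIV f p :> grad f p" for p
    using A1(1) unfolding continuously_differentiable_def by (blast intro: GDERIV_grad(1))
  have C1: "continuously_differentiable (grad_y g)"
    using A2(1) by (rule grad_y_continuously_differentiable)
  have h_eq: "h = (\<lambda>p. (norm (grad_y g p))\<^sup>2)"
    using h_def by (rule ext)
  have h: "GDERIV h p :> grad h p" for p
    using GDERIV_norm_grad_y_squared[OF C1, of p] GDERIV_grad(1) unfolding h_eq gderiv_def by blast
  have cont: "continuous_on UNIV f" "continuous_on UNIV h"
    using f h unfolding gderiv_def continuous_on_eq_continuous_at[OF open_UNIV]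
    by (blast intro: has_derivative_continuous)+
  have compact: "compact {p. h p \<le> \<epsilon>\<^sup>2}"
    using A4 cont(2) by (rule sublevel_compact)
  have qp: "is_arg_min (qp_objective f (z k)) (qp_feasible h \<epsilon> \<alpha>\<^sub>b w (z k)) (dz k)" for k
    using alg unfolding generated_by_algorithm_def by auto

  \<comment> \<open>Invariance of the sublevel set, with a geometric bound\<close>
  have step: "h (z (Suc k)) - \<epsilon>\<^sup>2 \<le> (1 - \<gamma>) * (h (z k) - \<epsilon>\<^sup>2)" for k
    using alg by (auto simp: generated_by_algorithm_def first_backtrack_def safety_def)
  have nonpos: "(1 - \<gamma>) ^ K * (h (z 0) - \<epsilon>\<^sup>2) \<le> 0" for K
    using init unit_interval by (simp add: mult_nonneg_nonpos)
  have decay: "h (z K) - \<epsilon>\<^sup>2 \<le> (1 - \<gamma>) ^ K * (h (z 0) - \<epsilon>\<^sup>2)" for K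
  proof (induction K)
    case (Suc K)
    have "(1 - \<gamma>) * (h (z K) - \<epsilon>\<^sup>2) \<le> (1 - \<gamma>) * ((1 - \<gamma>) ^ K * (h (z 0) - \<epsilon>\<^sup>2))"
      using Suc unit_interval by (intro mult_left_mono) auto
    with step[of K] show ?case
      by (simp add: mult.assoc)
  qed simp
  have safe: "h (z k) \<le> \<epsilon>\<^sup>2" for k
    using decay[of k] nonpos[of k] by linarith
  have star: "f_star f h \<epsilon> \<le> f (z k)" for k
    using compact cont(1) safe by (rule f_star_le)
  \<comment> \<open>The Lipschitz constants stay free: the average bound uses given ones, the limit
    uses constructed ones.\<close>
  note bound = average_step_bound[OF f h star pos(2-4) unit_interval safe alg]

  \<comment> \<open>The average bound\<close>
  have "1 / real K * (\<Sum>k<K. (norm (dz k))\<^sup>2)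
      \<le> (f (z 0) - f_star f h \<epsilon>) / (\<alpha>\<^sub>l\<^sub>s * t_min \<alpha>\<^sub>b w t\<^sub>m\<^sub>a\<^sub>x \<beta> \<alpha>\<^sub>l\<^sub>s \<gamma> L\<^sub>f L\<^sub>h * real K)"
    if lip: "uniform_lipschitz_constants f h t\<^sub>m\<^sub>a\<^sub>x z dz L\<^sub>f L\<^sub>h" and "1 \<le> K" for L\<^sub>f L\<^sub>h and K :: nat
  proof -
    let ?c = "\<alpha>\<^sub>l\<^sub>s * t_min \<alpha>\<^sub>b w t\<^sub>m\<^sub>a\<^sub>x \<beta> \<alpha>\<^sub>l\<^sub>s \<gamma> L\<^sub>f L\<^sub>h"
    have "0 < ?c"
      using bound(1)[OF lip] unit_interval by simp
    then have "(\<Sum>k<K. (norm (dz k))\<^sup>2) \<le> (f (z 0) - f_star f h \<epsilon>) / ?c"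
      using bound(2)[OF lip, of K] by (simp add: pos_le_divide_eq mult.commute)
    then have "1 / real K * (\<Sum>k<K. (norm (dz k))\<^sup>2) \<le> 1 / real K * ((f (z 0) - f_star f h \<epsilon>) / ?c)"
      by (rule mult_left_mono) simp
    then show ?thesis
      by (simp add: mult.commute)
  qed

  \<comment> \<open>Convergence of the directions to zero\<close>
  moreover have "(\<lambda>k. norm (dz k)) \<longlonglongrightarrow> 0"
  proof -
    obtain B1 where B1: "\<And>p. h p \<le> \<epsilon>\<^sup>2 \<Longrightarrow> norm p \<le> B1"
      using compact_imp_bounded[OF compact] unfolding bounded_iff by auto
    obtain M where "M-lipschitz_on {p. h p \<le> \<epsilon>\<^sup>2} (grad f)"
      using locally_lipschitz_on_compact[OF A1(2) compact] .
    then have "bounded (grad f ` {p. h p \<le> \<epsilon>\<^sup>2})"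
      by (intro compact_imp_bounded compact_continuous_image lipschitz_on_continuous_on compact)
    then obtain B2 where B2: "\<And>p. h p \<le> \<epsilon>\<^sup>2 \<Longrightarrow> norm (grad f p) \<le> B2"
      unfolding bounded_iff by auto
    \<comment> \<open>Descent and Cauchy-Schwarz bound each direction by the gradient of
      \<open>f\<close>, which is bounded on the sublevel set.\<close>
    have dz: "norm (dz k) \<le> B2" for k
    proof -
      have "(norm (dz k))\<^sup>2 \<le> grad f (z k) \<bullet> - dz k"
        using qp_solution_descent[OF qp safe, of k] pos by simp
      also have "\<dots> \<le> norm (grad f (z k)) * norm (dz k)"
        using norm_cauchy_schwarz[of "grad f (z k)" "- dz k"] by simp
      finally have "norm (dz k) \<le> norm (grad f (z k))"
        by (cases "dz k = 0") (simp_all add: power2_eq_square)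
      then show ?thesis
        using B2[OF safe] by (rule order_trans)
    qed
    \<comment> \<open>The radius adds the bound on the iterates to the longest trial displacement,
      so the ball contains all trial points.\<close>
    define S :: "((real^'n) \<times> (real^'m)) set" where "S = cball 0 (B1 + t\<^sub>m\<^sub>a\<^sub>x * B2)"
    have "z k + s *\<^sub>R dz k \<in> S" if "s \<in> {0..t\<^sub>m\<^sub>a\<^sub>x}" for k s
    proof -
      have "norm (z k + s *\<^sub>R dz k) \<le> norm (z k) + \<bar>s\<bar> * norm (dz k)"
        using norm_triangle_ineq[of "z k" "s *\<^sub>R dz k"] by simp
      also have "\<dots> \<le> B1 + t\<^sub>m\<^sub>a\<^sub>x * B2"
        using that dz[of k] B1[OF safe[of k]] by (intro add_mono mult_mono) auto
      finally show ?thesis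
        by (simp add: S_def)
    qed
    moreover have S: "compact S" "convex S"
      by (simp_all add: S_def)
    moreover obtain L1 where "L1-lipschitz_on S (grad f)"
      using locally_lipschitz_on_compact[OF A1(2) S(1)] .
    \<comment> \<open>The constant obtained may be 0; raising it to at least 1 makes it
      admissible.\<close>
    then have "(max 1 L1)-lipschitz_on S (grad f)"
      by (rule lipschitz_on_le) simp
    moreover obtain L2 where "L2-lipschitz_on S (grad h)"
      using grad_norm_grad_y_squared_lipschitz_on_compact[OF C1 A2(2,3) S] unfolding h_eq .
    then have "(max 1 L2)-lipschitz_on S (grad h)"
      by (rule lipschitz_on_le) simp
    ultimately have lip: "uniform_lipschitz_constants f h t\<^sub>m\<^sub>a\<^sub>x z dz (max 1 L1) (max 1 L2)"
      unfolding uniform_lipschitz_constants_def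
      by (intro conjI exI[of _ S]) (auto intro: compact_imp_bounded)
    let ?c = "\<alpha>\<^sub>l\<^sub>s * t_min \<alpha>\<^sub>b w t\<^sub>m\<^sub>a\<^sub>x \<beta> \<alpha>\<^sub>l\<^sub>s \<gamma> (max 1 L1) (max 1 L2)"
    have "0 < ?c"
      using bound(1)[OF lip] unit_interval by simp
    then have "(\<Sum>k<K. (norm (dz k))\<^sup>2) \<le> (f (z 0) - f_star f h \<epsilon>) / ?c" for K
      using bound(2)[OF lip, of K] by (simp add: pos_le_divide_eq mult.commute)
    \<comment> \<open>The bound on the partial sums is independent of \<open>K\<close>, and the
      terms are nonnegative.\<close>
    then have "summable (\<lambda>k. (norm (dz k))\<^sup>2)"
      by (intro summableI_nonneg_bounded) auto
    then have "(\<lambda>k. (norm (dz k))\<^sup>2) \<longlonglongrightarrow> 0"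
      by (rule summable_LIMSEQ_zero)
    from tendsto_real_sqrt[OF this] show ?thesis
      by simp
  qed
  ultimately show ?thesis
    using decay nonpos by blast
qed

end
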